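(* Let $G$ be a distribution function on $[0,\infty)$ that is controlled near $0$. Then for every non-decreasing function $f:\mathbb{N}_0\to\mathbb{N}$, $$f\text{ is }G\text{-small}\iff f\text{ is }G\text{-explosive}.$$
   Context: $\mathbb{N}=\{1,2,\dots\}$, $\mathbb{N}_0=\mathbb{N}\cup\{0\}$. $G:[0,\infty)\to[0,1]$ is the distribution function of a non-negative random variable, and $G^{-1}(y)=\inf\{x\ge0: G(x)\ge y\}$ (with $\inf\emptyset=+\infty$). $G$ is controlled near $0$ if there is a constant $c>1$ such that $$1<\liminf_{x\to0}\frac{G(cx)}{G(x)}\le\limsup_{x\to0}\frac{G(cx)}{G(x)}<\infty$$ (limits as $x\downarrow0$; in particular $G(x)>0$ for $x>0$). For $f:\mathbb{N}_0\to\mathbb{N}$, $T_f$ is the spherically symmetric rooted tree in which each node of generation $n$ (distance $n$ from the root) has exactly $f(n)$ children, and $T_f^G$ is the randomly weighted tree obtained by giving the edges of $T_f$ i.i.d. weights with distribution function $G$. For a rooted weighted tree $T$, $m_n(T)$ is the minimum, over paths from the root to a node of generation $n$, of the sum of the edge weights on the path. $T$ is explosive if $\lim_{n\to\infty}m_n(T)<\infty$. A non-decreasing $f$ is $G$-explosive if $T_f^G$ is explosive almost surely. A non-decreasing $f$ is $G$-small if $\sum_{n} G^{-1}(f(n)^{-1})<\infty$, where the sum is over $n\ge N$ for some $N\in\mathbb{N}_0$ (i.e. finitely many initial terms are ignored). *)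

theory Defs
  imports "HOL-Probability.Probability"
begin

section \<open>Distribution functions on the half-line\<close>

text \<open>
  A distribution function \<open>G\<close> on \<open>[0,\<infinity>)\<close> is represented by its extension by 0 to the whole real
  line, i.e. as the cdf of the law \<open>\<mu>\<close> of a non-negative random variable.
\<close>

definition nonneg_distribution_function :: "(real \<Rightarrow> real) \<Rightarrow> bool" where
  "nonneg_distribution_function G \<longleftrightarrow>
     (\<exists>\<mu>. real_distribution \<mu> \<and> (AE x in \<mu>. 0 \<le> x) \<and> G = cdf \<mu>)"

text \<open>The value is \<open>\<infinity>\<close> if no \<open>x\<close> satisfies \<open>G x \<ge> y\<close>, since \<open>Inf {} = \<infinity>\<close> in \<^typ>\<open>ennreal\<close>.\<close>

definition gen_inverse :: "(real \<Rightarrow> real) \<Rightarrow> real \<Rightarrow> ennreal" where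
  "gen_inverse G y = Inf (ennreal ` {x. 0 \<le> x \<and> y \<le> G x})"

text \<open>
  The positivity clause makes the quotients meaningful; in HOL, where \<open>a / 0 = 0\<close>, it also follows
  from the condition on the limit inferior.
\<close>

definition controlled_near_0 :: "(real \<Rightarrow> real) \<Rightarrow> bool" where
  "controlled_near_0 G \<longleftrightarrow>
     (\<forall>x>0. 0 < G x) \<and>
     (\<exists>c>1. 1 < Liminf (at_right 0) (\<lambda>x. ereal (G (c * x) / G x)) \<and>
            Limsup (at_right 0) (\<lambda>x. ereal (G (c * x) / G x)) < \<infinity>)"

section \<open>Spherically symmetric trees and weights\<close>

text \<open>
  Rooted trees are given by their Ulam--Harris labels: the root is \<open>[]\<close>, the children of \<open>v\<close> are of
  the form \<open>v @ [i]\<close>, and the generation of \<open>v\<close> is its length. An edge is identified with its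
  endpoint farther from the root, so the edges are the nodes other than \<open>[]\<close>.
\<close>

definition sph_tree :: "(nat \<Rightarrow> nat) \<Rightarrow> nat list set" where
  "sph_tree f = {v. \<forall>k < length v. v ! k < f k}"

definition tree_edges :: "nat list set \<Rightarrow> nat list set" where
  "tree_edges T = T - {[]}"

text \<open>The path from the root to \<open>v\<close> traverses the edges ending in the non-empty prefixes of \<open>v\<close>.\<close>

definition path_weight :: "(nat list \<Rightarrow> real) \<Rightarrow> nat list \<Rightarrow> real" where
  "path_weight w v = (\<Sum>k = 1..length v. w (take k v))"

text \<open>Meaningful for trees with finite non-empty generations.\<close>

definition min_weight :: "nat list set \<Rightarrow> (nat list \<Rightarrow> real) \<Rightarrow> nat \<Rightarrow> real" where
  "min_weight T w n = Min (path_weight w ` {v \<in> T. length v = n})"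

definition explosive :: "nat list set \<Rightarrow> (nat list \<Rightarrow> real) \<Rightarrow> bool" where
  "explosive T w \<longleftrightarrow> (\<exists>L<\<infinity>. (\<lambda>n. ereal (min_weight T w n)) \<longlonglongrightarrow> L)"

text \<open>
  The law of the i.i.d. edge weights. Here \<^term>\<open>interval_measure G\<close> is the probability measure
  on the reals with distribution function \<open>G\<close>, see \<open>interval_measure_distribution\<close> below.
\<close>

definition edge_weights :: "(real \<Rightarrow> real) \<Rightarrow> nat list set \<Rightarrow> (nat list \<Rightarrow> real) measure" where
  "edge_weights G T = PiM (tree_edges T) (\<lambda>_. interval_measure G)"

definition G_explosive :: "(real \<Rightarrow> real) \<Rightarrow> (nat \<Rightarrow> nat) \<Rightarrow> bool" where
  "G_explosive G f \<longleftrightarrow> (AE w in edge_weights G (sph_tree f). explosive (sph_tree f) w)"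

definition G_small :: "(real \<Rightarrow> real) \<Rightarrow> (nat \<Rightarrow> nat) \<Rightarrow> bool" where
  "G_small G f \<longleftrightarrow> (\<exists>N. (\<Sum>n. gen_inverse G (1 / real (f (n + N)))) < \<infinity>)"

section \<open>Sanity checks\<close>

lemma interval_measure_distribution:
  assumes "nonneg_distribution_function G"
  shows "real_distribution (interval_measure G)" "cdf (interval_measure G) = G"
    "AE x in interval_measure G. 0 \<le> x"
proof -
  obtain \<mu> where \<mu>: "real_distribution \<mu>" "AE x in \<mu>. 0 \<le> x" "G = cdf \<mu>"
    using assms unfolding nonneg_distribution_function_def by blast
  interpret real_distribution \<mu> by fact
  have "real_distribution (interval_measure (cdf \<mu>))"
    using cdf_nondecreasing cdf_is_right_cont cdf_lim_at_bot cdf_lim_at_top_prob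
    by (intro real_distribution_interval_measure) auto
  moreover have "cdf (interval_measure (cdf \<mu>)) = cdf \<mu>"
    using cdf_nondecreasing cdf_is_right_cont cdf_lim_at_bot cdf_lim_at_top_prob
    by (intro cdf_interval_measure) auto
  ultimately show *: "real_distribution (interval_measure G)" "cdf (interval_measure G) = G"
    by (simp_all add: \<mu>(3))
  have "interval_measure G = \<mu>"
    using *(1) \<mu>(1) *(2) \<mu>(3) by (intro cdf_unique) auto
  with \<mu>(2) show "AE x in interval_measure G. 0 \<le> x" by metis
qed

lemma finite_generation: "finite {v \<in> sph_tree f. length v = n}"
proof (rule finite_subset)
  show "{v \<in> sph_tree f. length v = n} \<subseteq> {v. set v \<subseteq> (\<Union>k<n. {..<f k}) \<and> length v = n}"
    by (force simp: sph_tree_def in_set_conv_nth)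
qed (rule finite_lists_length_eq, auto)

lemma generation_nonempty:
  assumes "\<forall>n. 1 \<le> f n"
  shows "{v \<in> sph_tree f. length v = n} \<noteq> {}"
proof -
  have "replicate n 0 \<in> {v \<in> sph_tree f. length v = n}"
    using assms by (auto simp: sph_tree_def Suc_le_eq)
  thus ?thesis by blast
qed

lemma children_sph_tree:
  assumes "v \<in> sph_tree f"
  shows "{i. v @ [i] \<in> sph_tree f} = {..<f (length v)}"
  using assms by (auto simp: sph_tree_def nth_append less_Suc_eq)

end

theory Submission
  imports Defs
begin

text \<open>
  Write \<open>q n = G\<^sup>-\<^sup>1 (1 / f n)\<close>. This is the order of magnitude of the cheapest of the \<open>f n\<close> edges
  leaving a vertex of generation \<open>n\<close>. Control near 0 says that multiplying an argument by a large
  constant multiplies \<open>G\<close> by a large constant (\<open>controlled_near_0_decay\<close>) and that \<open>G\<close> grows at most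
  polynomially (\<open>controlled_near_0_le_ratio\<close>). So everything happens at the scales \<open>q n\<close>, up to
  constants.

  Suppose that \<open>q\<close> is summable from some index on. For a large constant \<open>A\<close>, a vertex of generation
  \<open>n\<close> has in the mean a large number of children behind edges of weight at most \<open>A * q n\<close>, for all
  large \<open>n\<close>. The tree formed by these edges is a supercritical branching process in a varying
  environment, whose extinction probability is at most \<open>e\<close> if \<open>A\<close> is large enough, uniformly in the
  starting generation (\<open>prob_no_open_path_le\<close>). A path of this tree has finite total weight, so there
  is explosion with probability at least \<open>1 - e\<close>, for every \<open>e > 0\<close> (\<open>AE_explosive\<close>).

  Suppose that \<open>q\<close> is not summable. The plain first moment of the number of light paths is useless
  here: it may be dominated by the rare event that a path is exceptionally light in the early
  generations and then has very many continuations. The remedy is a barrier: let \<open>b\<close> have increments \<open>1 / \<beta> n\<close>, where \<open>\<beta> n\<close> is a large multiple of \<open>1 / q n\<close>,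
  so that \<open>b n\<close> tends to infinity, and count only the vertices at which a path drops below the barrier
  for the first time. Since \<open>f\<close>, and with it \<open>\<beta>\<close>, is nondecreasing, summation by parts bounds the
  indicator of a first passage in generation \<open>n + 1\<close> by a product of exponentials
  \<open>exp (1 - \<beta> j * X j)\<close>, \<open>j \<le> n\<close>, of the independent weights on the path
  (\<open>exp_product_at_first_passage\<close>). The Laplace transform estimate \<open>laplace_le_cdf\<close> makes the
  expectation of each factor at most \<open>1 / (4 * f j)\<close>. The expected number of first passages is then at
  most 1/3, so with positive probability no path ever drops below the barrier, and then there is
  no explosion (\<open>not_AE_explosive\<close>).
\<close>

section \<open>Distribution functions controlled near 0\<close>

text \<open>
  The upper bound on the quotients holds a priori only near 0. Away from 0 it costs nothing, because
  \<open>G\<close> is bounded by 1 and bounded below by a positive constant there; having it on the whole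
  half-line spares all later truncations.
\<close>

lemma controlled_near_0_le_ratio:
  assumes "controlled_near_0 G" "mono G" "\<And>x. G x \<le> 1"
  obtains c K where "c > 1" "K > 0" "\<And>x. 0 < x \<Longrightarrow> G (c * x) \<le> K * G x"
proof -
  from assms(1) obtain c where pos: "\<And>x. x > 0 \<Longrightarrow> 0 < G x" and c: "c > 1"
    and lim: "Limsup (at_right 0) (\<lambda>x. ereal (G (c * x) / G x)) < \<infinity>"
    unfolding controlled_near_0_def by blast
  obtain K where "Limsup (at_right 0) (\<lambda>x. ereal (G (c * x) / G x)) < ereal K"
    using lim less_PInf_Ex_of_nat by fastforce
  from Limsup_lessD[OF this]
  obtain b where b: "b > 0" "\<And>x. 0 < x \<Longrightarrow> x < b \<Longrightarrow> G (c * x) / G x < K"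
    unfolding eventually_at_right_field by auto
  define K' where "K' = max K (1 / G b)"
  have "G (c * x) \<le> K' * G x" if "x > 0" for x
  proof (cases "x < b")
    case True
    then have "G (c * x) / G x \<le> K'" using b(2)[OF that] by (simp add: K'_def)
    then show ?thesis using pos[OF that] by (simp add: field_simps)
  next
    case False
    then have "G b \<le> G x" using assms(2) by (auto simp: mono_def)
    then have "1 \<le> 1 / G b * G x" using pos[OF b(1)] by simp
    also have "\<dots> \<le> K' * G x" using pos[OF that] by (intro mult_right_mono) (auto simp: K'_def)
    finally show ?thesis using assms(3)[of "c * x"] by linarith
  qed
  moreover have "K' > 0" using pos[OF b(1)] by (simp add: K'_def less_max_iff_disj)
  ultimately show ?thesis using that c by blast
qed

text \<open>
  Iterating the lower bound on the quotients: shrinking the argument by a suitable constant factor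
  shrinks \<open>G\<close> by any prescribed factor, uniformly near 0. Read from left to right this makes an edge
  much cheaper than \<open>G\<^sup>-\<^sup>1 (1 / f n)\<close> unlikely; read from right to left it makes the expected number of
  children reached by an edge of weight at most a large multiple of \<open>G\<^sup>-\<^sup>1 (1 / f n)\<close> large.
\<close>

lemma controlled_near_0_decay:
  assumes "controlled_near_0 G"
  obtains x0 where "x0 > 0"
    "\<And>e. e > 0 \<Longrightarrow> \<exists>\<theta>>0. \<theta> < 1 \<and> (\<forall>x. 0 < x \<longrightarrow> x \<le> x0 \<longrightarrow> G (\<theta> * x) \<le> e * G x)"
proof -
  from assms obtain c where pos: "\<And>x. x > 0 \<Longrightarrow> 0 < G x" and c: "c > 1"
    and lim: "1 < Liminf (at_right 0) (\<lambda>x. ereal (G (c * x) / G x))"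
    unfolding controlled_near_0_def by blast
  obtain l where l: "1 < ereal l" "ereal l < Liminf (at_right 0) (\<lambda>x. ereal (G (c * x) / G x))"
    using ereal_dense2[OF lim] by auto
  from less_LiminfD[OF l(2)]
  obtain b where b: "b > 0" "\<And>x. 0 < x \<Longrightarrow> x < b \<Longrightarrow> l < G (c * x) / G x"
    unfolding eventually_at_right_field by auto
  have l1: "l > 1" using l(1) by simp
  have iter: "l ^ m * G (x / c ^ m) \<le> G x" if "0 < x" "x \<le> b" for x m
  proof (induction m)
    case (Suc m)
    let ?y = "x / c ^ Suc m"
    have "?y > 0" using that c by simp
    moreover have "?y < b"
    proof -
      have "1 < c ^ Suc m" using c by (intro one_less_power) auto
      then have "?y < x" using that by (simp add: field_simps)
      then show ?thesis using that by linarith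
    qed
    ultimately have "l * G ?y \<le> G (c * ?y)"
      using b(2)[of ?y] pos[of ?y] by (simp add: field_simps)
    also have "c * ?y = x / c ^ m" using c by simp
    finally have "l ^ m * (l * G ?y) \<le> l ^ m * G (x / c ^ m)"
      using l1 by (intro mult_left_mono) auto
    with Suc show ?case by (simp add: mult_ac)
  qed simp
  have "\<exists>\<theta>>0. \<theta> < 1 \<and> (\<forall>x. 0 < x \<longrightarrow> x \<le> b \<longrightarrow> G (\<theta> * x) \<le> e * G x)" if "e > 0" for e
  proof -
    obtain m where m: "l ^ m > 1 / e" using real_arch_pow[OF l1] by blast
    define n where "n = Suc m"
    have n: "l ^ n > 1 / e"
    proof -
      have "l ^ m \<le> l ^ n" using l1 unfolding n_def by (intro power_increasing) auto
      with m show ?thesis by linarith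
    qed
    show ?thesis
    proof (intro exI[of _ "1 / c ^ n"] conjI allI impI)
      show "1 / c ^ n < 1" using c one_less_power[of c n] by (simp add: n_def)
      fix x assume x: "0 < x" "x \<le> b"
      have "1 / e * G (x / c ^ n) \<le> l ^ n * G (x / c ^ n)"
        using n x c less_imp_le[OF pos[of "x / c ^ n"]] by (intro mult_right_mono) auto
      also have "\<dots> \<le> G x" by (rule iter[OF x])
      finally show "G (1 / c ^ n * x) \<le> e * G x" using that by (simp add: field_simps)
    qed (use c in auto)
  qed
  with b(1) that show ?thesis by blast
qed

lemma ennreal_term_le_suminf: "g j \<le> (\<Sum>i. g i)" for g :: "nat \<Rightarrow> ennreal"
  using sum_le_suminf[of g "{j}"] by simp

lemma summable_exp_minus_power:
  fixes c K :: real
  assumes "c > 1" "K > 0"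
  shows "summable (\<lambda>i. exp (- (c ^ i)) * K ^ i)"
proof -
  obtain N where N: "c ^ N > 2 * K / (c - 1)" using real_arch_pow[OF assms(1)] by blast
  show ?thesis
  proof (rule summable_ratio_test[of "1/2" N])
    fix n assume "n \<ge> N"
    then have "c ^ N \<le> c ^ n" using assms by (intro power_increasing) auto
    have "2 * K < c ^ N * (c - 1)" using N assms by (simp add: field_simps)
    also have "\<dots> \<le> c ^ n * (c - 1)" using \<open>c ^ N \<le> c ^ n\<close> assms by (intro mult_right_mono) auto
    also have "\<dots> \<le> exp (c ^ n * (c - 1))"
      using exp_ge_add_one_self[of "c ^ n * (c - 1)"] by linarith
    finally have "2 * K < exp (c ^ n * (c - 1))" .
    moreover have "K * exp (- t) \<le> 1 / 2" if "2 * K < exp t" for t :: real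
      using that by (simp add: exp_minus field_simps)
    ultimately have "K * exp (- (c ^ n * (c - 1))) \<le> 1 / 2" by blast
    then have "exp (- (c ^ n)) * K ^ n * (K * exp (- (c ^ n * (c - 1)))) \<le> exp (- (c ^ n)) * K ^ n * (1/2)"
      using assms by (intro mult_left_mono) auto
    moreover have "exp (- (c ^ Suc n)) = exp (- (c ^ n)) * exp (- (c ^ n * (c - 1)))"
      by (simp add: exp_add[symmetric] algebra_simps)
    ultimately show "norm (exp (- (c ^ Suc n)) * K ^ Suc n) \<le> 1 / 2 * norm (exp (- (c ^ n)) * K ^ n)"
      using assms by (simp add: mult_ac)
  qed simp
qed

text \<open>
  An Abelian estimate for the Laplace transform \<open>E exp (- X / y)\<close>: the contribution of the shell
  \<open>y * c ^ i < X \<le> y * c ^ Suc i\<close> is at most \<open>exp (- (c ^ i)) * K ^ Suc i * G y\<close>, as \<open>G\<close> grows by at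
  most a factor \<open>K\<close> per shell, and these bounds are summable.
\<close>

lemma laplace_le_cdf:
  fixes c K :: real
  assumes P: "real_distribution P" "AE x in P. 0 \<le> x"
    and c: "c > 1" "K > 0" "\<And>x. 0 < x \<Longrightarrow> cdf P (c * x) \<le> K * cdf P x"
  obtains B where "B > 0"
    "\<And>y. y > 0 \<Longrightarrow> (\<integral>\<^sup>+ x. ennreal (exp (- x / y)) \<partial>P) \<le> ennreal (B * cdf P y)"
proof -
  interpret real_distribution P by fact
  define a where "a j = (case j of 0 \<Rightarrow> 1 | Suc i \<Rightarrow> exp (- (c ^ i)))" for j
  have a0: "a j \<ge> 0" for j by (simp add: a_def split: nat.split)
  have sm: "summable (\<lambda>j. a j * K ^ j)"
    using summable_mult2[OF summable_exp_minus_power[OF c(1,2)], of K]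
    by (subst summable_Suc_iff[symmetric]) (simp add: a_def mult_ac)
  define B where "B = (\<Sum>j. a j * K ^ j)"
  have "(\<integral>\<^sup>+ x. ennreal (exp (- x / y)) \<partial>P) \<le> ennreal (B * cdf P y)" if y: "y > 0" for y
  proof -
    have pt: "ennreal (exp (- x / y)) \<le> (\<Sum>j. ennreal (a j) * indicator {..y * c ^ j} x)"
      if x: "0 \<le> x" for x
    proof -
      \<comment> \<open>The first index whose interval contains \<open>x\<close> alone provides a large enough term.\<close>
      obtain m where "c ^ m > x / y" using real_arch_pow[OF c(1)] by blast
      then have ex: "x \<le> y * c ^ m" using y by (simp add: field_simps)
      define j where "j = (LEAST j. x \<le> y * c ^ j)"
      have j: "x \<le> y * c ^ j" unfolding j_def using ex by (rule LeastI)
      have "exp (- x / y) \<le> a j"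
      proof (cases j)
        case 0 then show ?thesis using x y by (simp add: a_def)
      next
        case (Suc i)
        then have "\<not> x \<le> y * c ^ i" using not_less_Least[of i "\<lambda>j. x \<le> y * c ^ j"] unfolding j_def by simp
        then have "c ^ i \<le> x / y" using y by (simp add: field_simps)
        then show ?thesis using Suc by (simp add: a_def)
      qed
      then have "ennreal (exp (- x / y)) \<le> ennreal (a j) * indicator {..y * c ^ j} x"
        using j by (simp add: ennreal_leI)
      also have "\<dots> \<le> (\<Sum>j. ennreal (a j) * indicator {..y * c ^ j} x)"
        by (rule ennreal_term_le_suminf)
      finally show ?thesis .
    qed
    have dbl: "cdf P (y * c ^ j) \<le> K ^ j * cdf P y" for j
    proof (induction j)
      case (Suc j)
      have "cdf P (c * (y * c ^ j)) \<le> K * cdf P (y * c ^ j)" using c(1) y by (intro c(3)) simp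
      also have "\<dots> \<le> K * (K ^ j * cdf P y)" using Suc c(2) by (intro mult_left_mono) auto
      finally show ?case by (simp add: mult_ac)
    qed simp
    have "(\<integral>\<^sup>+ x. ennreal (exp (- x / y)) \<partial>P)
        \<le> (\<integral>\<^sup>+ x. (\<Sum>j. ennreal (a j) * indicator {..y * c ^ j} x) \<partial>P)"
      by (rule nn_integral_mono_AE, rule eventually_mono[OF P(2)], rule pt)
    also have "\<dots> = (\<Sum>j. \<integral>\<^sup>+ x. ennreal (a j) * indicator {..y * c ^ j} x \<partial>P)"
      by (intro nn_integral_suminf) measurable
    also have "\<dots> = (\<Sum>j. ennreal (a j * cdf P (y * c ^ j)))"
      by (subst nn_integral_cmult_indicator)
        (auto simp: emeasure_eq_measure cdf_def a0 ennreal_mult)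
    also have "\<dots> \<le> (\<Sum>j. ennreal (a j * K ^ j * cdf P y))"
      using a0 dbl by (intro suminf_le ennreal_leI) (auto intro: mult_left_mono simp: mult.assoc)
    also have "\<dots> = ennreal (B * cdf P y)"
      using a0 c(2) unfolding B_def suminf_mult2[OF sm]
      by (intro suminf_ennreal2 summable_mult2 sm) (auto simp: cdf_nonneg)
    finally show ?thesis .
  qed
  moreover have "B > 0"
  proof -
    have "a 0 * K ^ 0 \<le> B" unfolding B_def
      using sum_le_suminf[OF sm, of "{0}"] a0 c(2) by simp
    then show ?thesis by (simp add: a_def)
  qed
  ultimately show ?thesis using that by blast
qed

section \<open>Finitely many coordinates of an infinite product\<close>

lemma nn_integral_PiM_prod:
  fixes P :: "real measure"
  assumes "prob_space P" "finite J" "J \<subseteq> I" "\<And>i. i \<in> J \<Longrightarrow> g i \<in> borel_measurable P"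
  shows "(\<integral>\<^sup>+ w. (\<Prod>i\<in>J. g i (w i)) \<partial>PiM I (\<lambda>_. P)) = (\<Prod>i\<in>J. \<integral>\<^sup>+ x. g i x \<partial>P)"
proof -
  interpret N: prob_space P by fact
  interpret product_prob_space "\<lambda>_. P" I by unfold_locales
  have [measurable]: "(\<lambda>w. \<Prod>i\<in>J. g i (w i)) \<in> borel_measurable (PiM J (\<lambda>_. P))"
    using assms(4) by (intro borel_measurable_prod_ennreal) (auto intro: measurable_compose[OF measurable_component_singleton])
  have "(\<integral>\<^sup>+ w. (\<Prod>i\<in>J. g i (w i)) \<partial>PiM I (\<lambda>_. P))
      = (\<integral>\<^sup>+ w. (\<Prod>i\<in>J. g i (restrict w J i)) \<partial>PiM I (\<lambda>_. P))"
    by (intro nn_integral_cong prod.cong) auto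
  also have "\<dots> = (\<integral>\<^sup>+ w. (\<Prod>i\<in>J. g i (w i)) \<partial>distr (PiM I (\<lambda>_. P)) (PiM J (\<lambda>_. P)) (\<lambda>x. restrict x J))"
    using assms(3) by (subst nn_integral_distr) (auto intro!: measurable_restrict_subset)
  also have "\<dots> = (\<Prod>i\<in>J. \<integral>\<^sup>+ x. g i x \<partial>P)"
    using assms by (subst distr_PiM_restrict_finite) (auto intro!: product_nn_integral_prod)
  finally show ?thesis .
qed

section \<open>Paths in spherically symmetric trees\<close>

lemma sph_tree_take:
  assumes "v \<in> sph_tree f" shows "take k v \<in> sph_tree f"
  using assms by (auto simp: sph_tree_def)

lemma take_Suc_in_tree_edges:
  assumes "v \<in> sph_tree f" "j < length v" shows "take (Suc j) v \<in> tree_edges (sph_tree f)"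
  using sph_tree_take[OF assms(1), of "Suc j"] assms(2) by (auto simp: tree_edges_def)

lemma path_weight_eq_sum_lessThan: "path_weight w v = (\<Sum>j<length v. w (take (Suc j) v))"
  unfolding path_weight_def
  by (rule sum.reindex_bij_witness[of _ Suc "\<lambda>k. k - 1"]) auto

lemma generation_Suc:
  "{v \<in> sph_tree f. length v = Suc n} =
     (\<lambda>(v, i). v @ [i]) ` ({v \<in> sph_tree f. length v = n} \<times> {..<f n})" (is "?L = ?R")
proof
  show "?R \<subseteq> ?L" by (auto simp: sph_tree_def nth_append less_Suc_eq)
  show "?L \<subseteq> ?R"
  proof
    fix v assume v: "v \<in> ?L"
    then have "v \<noteq> []" by auto
    with v have "v = butlast v @ [last v]" "length v = Suc n"
      by auto
    moreover from v \<open>v \<noteq> []\<close> have "last v < f n" by (auto simp: sph_tree_def last_conv_nth)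
    moreover have "butlast v \<in> sph_tree f" using v by (auto simp: sph_tree_def nth_butlast)
    ultimately show "v \<in> ?R" by (intro image_eqI[of _ _ "(butlast v, last v)"]) auto
  qed
qed

lemma card_generation: "card {v \<in> sph_tree f. length v = n} = (\<Prod>k<n. f k)"
proof (induction n)
  case 0
  have "{v \<in> sph_tree f. length v = 0} = {[]}" by (auto simp: sph_tree_def)
  then show ?case by simp
next
  case (Suc n)
  have "inj_on (\<lambda>(v, i). v @ [i]) ({v \<in> sph_tree f. length v = n} \<times> {..<f n})"
    by (auto simp: inj_on_def)
  with Suc show ?case
    by (simp only: generation_Suc card_image card_cartesian_product card_lessThan) simp
qed

section \<open>Absence of explosion by a first passage argument\<close>

text \<open>
  Let \<open>D k\<close> be the distance of the walk \<open>X 0 + ... + X (k - 1)\<close> above the barrier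
  \<open>1 / \<beta> 0 + ... + 1 / \<beta> (k - 1)\<close>. At the first time \<open>m\<close> with \<open>D m < 0\<close> all earlier distances are
  nonnegative, so replacing the weight \<open>\<beta> i\<close> of such a distance by the larger \<open>\<beta> (Suc i)\<close> only
  increases it, and summation by parts gives
  \<open>(\<Sum>j<m. \<beta> j * (D (Suc j) - D j)) \<le> \<beta> (m - 1) * D m \<le> 0\<close>. Thus the exponential weights may become
  stronger and stronger along the path, although the first passage is a single event. The resulting
  product has independent factors when the steps \<open>X j\<close> are independent.
\<close>

lemma exp_product_at_first_passage:
  fixes X \<beta> :: "nat \<Rightarrow> real"
  assumes "mono \<beta>" "\<And>j. 0 < \<beta> j" "(\<Sum>j<n. X j) < (\<Sum>j<n. 1 / \<beta> j)"
  obtains k where "k < n" "1 \<le> (\<Prod>j<Suc k. exp (1 - \<beta> j * X j))"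
proof -
  define D where "D k = (\<Sum>j<k. X j - 1 / \<beta> j)" for k
  have "D n < 0" using assms(3) by (simp add: D_def sum_subtractf)
  define m where "m = (LEAST k. D k < 0)"
  have m: "D m < 0" "m \<le> n" unfolding m_def using \<open>D n < 0\<close> by (auto intro: LeastI Least_le)
  have before: "0 \<le> D k" if "k < m" for k
    using not_less_Least[of k "\<lambda>k. D k < 0"] that unfolding m_def by force
  have "D 0 = 0" by (simp add: D_def)
  with m obtain k where k: "m = Suc k" by (cases m) auto
  have "(\<Sum>j<Suc i. \<beta> j * (D (Suc j) - D j)) \<le> \<beta> i * D (Suc i)" if "i \<le> k" for i
    using that
  proof (induction i)
    case (Suc i)
    have "\<beta> i * D (Suc i) \<le> \<beta> (Suc i) * D (Suc i)"
      using before[of "Suc i"] Suc.prems k assms(1) by (intro mult_right_mono) (auto simp: mono_def)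
    with Suc show ?case by (simp add: algebra_simps)
  qed (simp add: \<open>D 0 = 0\<close>)
  from this[of k] have "(\<Sum>j<Suc k. \<beta> j * (D (Suc j) - D j)) \<le> \<beta> k * D m" using k by simp
  also have "\<dots> \<le> 0" using m assms(2)[of k] by (simp add: mult_le_0_iff)
  also have "(\<Sum>j<Suc k. \<beta> j * (D (Suc j) - D j)) = - (\<Sum>j<Suc k. 1 - \<beta> j * X j)"
    using assms(2) by (subst sum_negf[symmetric], intro sum.cong)
      (auto simp: D_def algebra_simps less_imp_neq[symmetric])
  finally have "1 \<le> exp (\<Sum>j<Suc k. 1 - \<beta> j * X j)" by simp
  also have "\<dots> = (\<Prod>j<Suc k. exp (1 - \<beta> j * X j))" by (rule exp_sum) simp
  finally show ?thesis using that[of k] m k by simp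
qed

text \<open>
  A first moment bound over the vertices at which a path passes below the barrier for the first time:
  there are \<open>f 0 * ... * f k\<close> vertices of generation \<open>k + 1\<close>, each of which contributes at most
  \<open>1 / (4 * f 0) * ... * 1 / (4 * f k)\<close>, so the barrier is crossed with probability at most
  \<open>1/4 + 1/16 + ... = 1/3\<close>. If it is never crossed, all path weights of generation \<open>n\<close> are at least the
  value of the barrier there, which diverges. That this has positive probability refutes almost sure
  explosion.
\<close>

lemma not_AE_explosive:
  fixes P :: "real measure" and \<beta> :: "nat \<Rightarrow> real"
  assumes P: "prob_space P" "sets P = sets borel"
    and f: "\<forall>n. 1 \<le> f n"
    and lam: "mono \<beta>" "\<And>j. 0 < \<beta> j" "filterlim (\<lambda>n. \<Sum>j<n. 1 / \<beta> j) at_top sequentially"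
    and lap: "\<And>j. (\<integral>\<^sup>+ x. ennreal (exp (1 - \<beta> j * x)) \<partial>P) \<le> ennreal (1 / (4 * real (f j)))"
  shows "\<not> (AE w in PiM (tree_edges (sph_tree f)) (\<lambda>_. P). explosive (sph_tree f) w)"
proof
  let ?T = "sph_tree f" and ?b = "\<lambda>n. \<Sum>j<n. 1 / \<beta> j"
  let ?M = "PiM (tree_edges ?T) (\<lambda>_. P)"
  let ?gen = "\<lambda>n. {v \<in> ?T. length v = n}"
  assume ae: "AE w in ?M. explosive ?T w"
  interpret P: prob_space P by fact
  interpret M: prob_space ?M by (intro prob_space_PiM P)
  note [measurable_cong] = P(2)
  define F where "F u w = (\<Prod>j<length u. ennreal (exp (1 - \<beta> j * w (take (Suc j) u))))"
    for u :: "nat list" and w :: "nat list \<Rightarrow> real"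
  have comp: "(\<lambda>w. w e) \<in> borel_measurable ?M" if "e \<in> tree_edges ?T" for e
    using measurable_component_singleton[OF that, of "\<lambda>_. P"] P(2) measurable_cong_sets by blast
  have Fm: "F u \<in> borel_measurable ?M" if "u \<in> ?T" for u
    unfolding F_def using comp[OF take_Suc_in_tree_edges[OF that]]
    by (intro borel_measurable_prod_ennreal) (auto intro!: measurable_compose[OF _ measurable_ennreal])
  have "(\<lambda>w. path_weight w v) \<in> borel_measurable ?M" if "v \<in> ?T" for v
    unfolding path_weight_eq_sum_lessThan
    using comp[OF take_Suc_in_tree_edges[OF that]] by (intro borel_measurable_sum) auto
  then have "{w \<in> space ?M. path_weight w v < ?b (length v)} \<in> sets ?M" if "v \<in> ?T" for v
    using that by measurable
  then have A: "{w \<in> space ?M. \<exists>v\<in>?T. path_weight w v < ?b (length v)} \<in> sets ?M" (is "?A \<in> _")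
    by (intro sets.sets_Collect_countable_Ex') auto
  have intF: "(\<integral>\<^sup>+ w. F u w \<partial>?M) \<le> (\<Prod>j<length u. ennreal (1 / (4 * real (f j))))" if u: "u \<in> ?T" for u
  proof -
    let ?J = "(\<lambda>j. take (Suc j) u) ` {..<length u}"
    let ?g = "\<lambda>e x. ennreal (exp (1 - \<beta> (length e - 1) * x))"
    have inj: "inj_on (\<lambda>j. take (Suc j) u) {..<length u}"
    proof (rule inj_onI)
      fix i j assume "i \<in> {..<length u}" "j \<in> {..<length u}" "take (Suc i) u = take (Suc j) u"
      then show "i = j" by (metis Suc_inject Suc_leI length_take lessThan_iff min.absorb2)
    qed
    have "F u = (\<lambda>w. \<Prod>e\<in>?J. ?g e (w e))"
      unfolding F_def by (subst prod.reindex[OF inj]) (auto intro!: ext prod.cong)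
    then have "(\<integral>\<^sup>+ w. F u w \<partial>?M) = (\<Prod>e\<in>?J. \<integral>\<^sup>+ x. ?g e x \<partial>P)"
      using take_Suc_in_tree_edges[OF u] P
      by (simp only:) (intro nn_integral_PiM_prod, auto)
    also have "\<dots> = (\<Prod>j<length u. \<integral>\<^sup>+ x. ennreal (exp (1 - \<beta> j * x)) \<partial>P)"
      by (subst prod.reindex[OF inj]) (auto intro!: prod.cong)
    also have "\<dots> \<le> (\<Prod>j<length u. ennreal (1 / (4 * real (f j))))"
      by (intro prod_mono_ennreal) (auto simp: lap)
    finally show ?thesis .
  qed
  have "emeasure ?M ?A = (\<integral>\<^sup>+ w. indicator ?A w \<partial>?M)" using A by simp
  also have "\<dots> \<le> (\<integral>\<^sup>+ w. (\<Sum>k. \<Sum>u\<in>?gen (Suc k). F u w) \<partial>?M)"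
  proof (intro nn_integral_mono)
    fix w
    show "indicator ?A w \<le> (\<Sum>k. \<Sum>u\<in>?gen (Suc k). F u w)"
    proof (cases "w \<in> ?A")
      case True
      then obtain v where v: "v \<in> ?T" "(\<Sum>j<length v. w (take (Suc j) v)) < ?b (length v)"
        by (auto simp: path_weight_eq_sum_lessThan)
      from exp_product_at_first_passage[OF lam(1,2) v(2)]
      obtain k where k: "k < length v" "1 \<le> (\<Prod>j<Suc k. exp (1 - \<beta> j * w (take (Suc j) v)))"
        by blast
      define u where "u = take (Suc k) v"
      have u: "u \<in> ?gen (Suc k)" using v k by (auto simp: u_def sph_tree_take)
      have "1 \<le> ennreal (\<Prod>j<Suc k. exp (1 - \<beta> j * w (take (Suc j) v)))"
        using k(2) by (subst ennreal_1[symmetric], intro ennreal_leI)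
      also have "\<dots> = (\<Prod>j<Suc k. ennreal (exp (1 - \<beta> j * w (take (Suc j) v))))"
        by (rule prod_ennreal[symmetric]) simp
      also have "\<dots> = (\<Prod>j<Suc k. ennreal (exp (1 - \<beta> j * w (take (Suc j) u))))"
        by (intro prod.cong) (auto simp: u_def min_def)
      also have "\<dots> = F u w" using u by (simp only: F_def mem_Collect_eq)
      also have "\<dots> \<le> (\<Sum>u\<in>?gen (Suc k). F u w)"
        using u finite_generation by (intro member_le_sum) auto
      also have "\<dots> \<le> (\<Sum>k. \<Sum>u\<in>?gen (Suc k). F u w)"
        by (rule ennreal_term_le_suminf)
      finally show ?thesis using True by simp
    qed simp
  qed
  also have "\<dots> = (\<Sum>k. \<Sum>u\<in>?gen (Suc k). \<integral>\<^sup>+ w. F u w \<partial>?M)"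
    using Fm by (subst nn_integral_suminf) (auto intro!: suminf_cong nn_integral_sum borel_measurable_sum)
  also have "\<dots> \<le> (\<Sum>k. ennreal ((1 / 4) ^ Suc k))"
  proof (intro suminf_le)
    fix k
    have "(\<Sum>u\<in>?gen (Suc k). \<integral>\<^sup>+ w. F u w \<partial>?M) \<le> (\<Sum>u\<in>?gen (Suc k). \<Prod>j<Suc k. ennreal (1 / (4 * real (f j))))"
      using intF by (intro sum_mono) force
    also have "\<dots> = ennreal (\<Prod>k<Suc k. real (f k)) * ennreal (\<Prod>j<Suc k. (1 / (4 * real (f j))))"
      by (simp only: sum_constant card_generation) (subst prod_ennreal, auto simp: ennreal_of_nat_eq_real_of_nat)
    also have "\<dots> = ennreal (\<Prod>j<Suc k. real (f j) * (1 / (4 * real (f j))))"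
      by (simp only: prod.distrib) (intro ennreal_mult[symmetric] prod_nonneg; simp)
    also have "(\<Prod>j<Suc k. real (f j) * (1 / (4 * real (f j)))) = (\<Prod>j<Suc k. 1 / 4)"
      using f by (intro prod.cong refl) (auto simp: field_simps Suc_le_eq)
    finally show "(\<Sum>u\<in>?gen (Suc k). \<integral>\<^sup>+ w. F u w \<partial>?M) \<le> ennreal ((1 / 4) ^ Suc k)" by simp
  qed auto
  also have "\<dots> = ennreal (1 / 3)"
  proof -
    have "(\<lambda>k. (1 / 4) * (1 / 4 :: real) ^ k) sums ((1 / 4) * (1 / (1 - 1 / 4)))"
      by (intro sums_mult geometric_sums) simp
    then have s: "(\<lambda>k. (1 / 4 :: real) ^ Suc k) sums (1 / 3)" by simp
    show ?thesis
      by (subst suminf_ennreal2[OF _ sums_summable[OF s]]) (simp_all only: sums_unique[OF s, symmetric], simp)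
  qed
  finally have small: "emeasure ?M ?A \<le> ennreal (1 / 3)" .
  have "AE w in ?M. w \<in> ?A"
    using ae AE_space
  proof eventually_elim
    fix w assume w: "explosive ?T w" "w \<in> space ?M"
    show "w \<in> ?A"
    proof (rule ccontr)
      assume "w \<notin> ?A"
      with w have ge: "?b (length v) \<le> path_weight w v" if "v \<in> ?T" for v
        using that by force
      have "?b n \<le> min_weight ?T w n" for n
        unfolding min_weight_def using generation_nonempty[OF f] finite_generation ge
        by (subst Min_ge_iff) auto
      then have "filterlim (\<lambda>n. min_weight ?T w n) at_top sequentially"
        by (intro filterlim_at_top_mono[OF lam(3)]) auto
      then have "(\<lambda>n. ereal (min_weight ?T w n)) \<longlonglongrightarrow> \<infinity>" by (simp add: tendsto_PInfty_eq_at_top)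
      with w(1) show False unfolding explosive_def using LIMSEQ_unique by fastforce
    qed
  qed
  then have "emeasure ?M ?A = 1" using A by (simp add: M.emeasure_eq_1_AE)
  with small show False by (simp add: ennreal_1[symmetric] del: ennreal_1)
qed

section \<open>Events depending on disjoint blocks of coordinates\<close>

lemma indep_vars_PiM_coordinates:
  fixes P :: "real measure"
  assumes "prob_space P" "I \<noteq> {}"
  shows "prob_space.indep_vars (PiM I (\<lambda>_. P)) (\<lambda>_. P) (\<lambda>i w. w i) I"
proof -
  interpret N: prob_space P by fact
  interpret product_prob_space "\<lambda>_. P" I by unfold_locales
  have "distr (PiM I (\<lambda>_. P)) (PiM I (\<lambda>_. P)) (\<lambda>x. \<lambda>i\<in>I. x i) = PiM I (\<lambda>_. P)"
    by (subst distr_cong[OF refl refl, of _ _ "\<lambda>x. x"])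
      (auto simp: space_PiM PiE_restrict distr_id2)
  moreover have "PiM I (\<lambda>i. distr (PiM I (\<lambda>_. P)) P (\<lambda>w. w i)) = PiM I (\<lambda>_. P)"
    by (intro PiM_cong refl PiM_component)
  ultimately show ?thesis
    using assms(2) by (subst P.indep_vars_iff_distr_eq_PiM') auto
qed

text \<open>
  That \<open>Q j\<close> depends on the coordinates in the block \<open>K j\<close> only is expressed by invariance under
  restriction to \<open>K j\<close>, so that one predicate can be read on the full product and on the block.
\<close>

lemma measure_PiM_disjoint_blocks:
  fixes P :: "real measure" and Q :: "'j \<Rightarrow> ('i \<Rightarrow> real) \<Rightarrow> bool"
  assumes P: "prob_space P" and L: "finite L" "L \<noteq> {}"
    and K: "I \<noteq> {}" "\<And>j. j \<in> L \<Longrightarrow> K j \<subseteq> I" "disjoint_family_on K L"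
    and Q: "\<And>j. j \<in> L \<Longrightarrow> {w \<in> space (PiM (K j) (\<lambda>_. P)). Q j w} \<in> sets (PiM (K j) (\<lambda>_. P))"
      "\<And>j w. j \<in> L \<Longrightarrow> Q j (restrict w (K j)) = Q j w"
  defines "M \<equiv> PiM I (\<lambda>_. P)"
  shows "measure M {w \<in> space M. \<forall>j\<in>L. Q j w} = (\<Prod>j\<in>L. measure M {w \<in> space M. Q j w})"
proof -
  interpret M: prob_space M unfolding M_def by (intro prob_space_PiM P)
  let ?A = "\<lambda>j. {w \<in> space (PiM (K j) (\<lambda>_. P)). Q j w}"
  let ?X = "\<lambda>j w. restrict (\<lambda>i. w i) (K j)"
  have "M.indep_vars (\<lambda>j. PiM (K j) (\<lambda>_. P)) ?X L"
    using indep_vars_PiM_coordinates[OF P K(1)] K(2,3)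
    unfolding M_def[symmetric] by (rule M.indep_vars_restrict)
  from M.indep_varsD_finite[OF this L(2,1), of ?A]
  have *: "measure M (\<Inter>j\<in>L. ?X j -` ?A j \<inter> space M) = (\<Prod>j\<in>L. measure M (?X j -` ?A j \<inter> space M))"
    using Q(1) by blast
  have "?X j w \<in> space (PiM (K j) (\<lambda>_. P))" if "j \<in> L" "w \<in> space M" for j w
    using K(2)[OF that(1)] that(2) by (auto simp: M_def space_PiM PiE_iff)
  then have eq: "?X j -` ?A j \<inter> space M = {w \<in> space M. Q j w}" if "j \<in> L" for j
    using that Q(2) by auto
  then have "(\<Inter>j\<in>L. ?X j -` ?A j \<inter> space M) = {w \<in> space M. \<forall>j\<in>L. Q j w}"
    using L(2) by auto
  moreover have "(\<Prod>j\<in>L. measure M (?X j -` ?A j \<inter> space M)) = (\<Prod>j\<in>L. measure M {w \<in> space M. Q j w})"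
    by (intro prod.cong refl) (simp only: eq)
  ultimately show ?thesis using * by (simp only:)
qed

lemma PiM_coordinate_event:
  fixes P :: "real measure"
  assumes "sets P = sets borel" "A \<in> sets borel" "i \<in> J"
  shows "{w \<in> space (PiM J (\<lambda>_. P)). w i \<in> A} \<in> sets (PiM J (\<lambda>_. P))"
proof -
  have "(\<lambda>w. w i) -` A \<inter> space (PiM J (\<lambda>_. P)) \<in> sets (PiM J (\<lambda>_. P))"
    by (rule measurable_sets[OF measurable_component_singleton[OF assms(3)]]) (simp add: assms(1,2))
  moreover have "(\<lambda>w. w i) -` A \<inter> space (PiM J (\<lambda>_. P)) = {w \<in> space (PiM J (\<lambda>_. P)). w i \<in> A}"
    by blast
  ultimately show ?thesis by (simp only:)
qed

section \<open>Survival of the subtree of cheap edges\<close>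

text \<open>
  From \<open>u\<close> one can descend \<open>m\<close> generations along edges whose weights lie in the set \<open>S k\<close> when they
  start in generation \<open>k\<close>. The recursion splits off the first edge because the subtrees hanging off
  distinct children of \<open>u\<close> are independent; it refers to the weights below \<open>u\<close> only.
\<close>

primrec open_path :: "(nat \<Rightarrow> nat) \<Rightarrow> (nat \<Rightarrow> real set) \<Rightarrow> nat \<Rightarrow> (nat list \<Rightarrow> real) \<Rightarrow> nat list \<Rightarrow> bool"
  where
    "open_path f S 0 w u = True"
  | "open_path f S (Suc m) w u =
       (\<exists>i<f (length u). w (u @ [i]) \<in> S (length u) \<and> open_path f S m w (u @ [i]))"

definition strict_descendants :: "(nat \<Rightarrow> nat) \<Rightarrow> nat list \<Rightarrow> nat list set" where
  "strict_descendants f u = {u @ i # v |i v. u @ i # v \<in> sph_tree f}"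

lemma strict_descendants_child: "strict_descendants f (u @ [i]) \<subseteq> strict_descendants f u"
  unfolding strict_descendants_def by auto

lemma strict_descendants_subset_tree_edges: "strict_descendants f u \<subseteq> tree_edges (sph_tree f)"
  unfolding strict_descendants_def tree_edges_def by auto

lemma child_in_sph_tree: "u \<in> sph_tree f \<Longrightarrow> i < f (length u) \<Longrightarrow> u @ [i] \<in> sph_tree f"
  using children_sph_tree by blast

lemma child_in_strict_descendants:
  "u \<in> sph_tree f \<Longrightarrow> i < f (length u) \<Longrightarrow> u @ [i] \<in> strict_descendants f u"
  using child_in_sph_tree unfolding strict_descendants_def by blast

lemma open_path_restrict:
  assumes "u \<in> sph_tree f" "strict_descendants f u \<subseteq> J"
  shows "open_path f S m (restrict w J) u = open_path f S m w u"
  using assms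
proof (induction m arbitrary: u)
  case (Suc m)
  have "open_path f S m (restrict w J) (u @ [i]) = open_path f S m w (u @ [i])"
    if "i < f (length u)" for i
    using strict_descendants_child[of f u i] Suc.prems(2)
    by (intro Suc.IH child_in_sph_tree[OF Suc.prems(1) that]) auto
  moreover have "restrict w J (u @ [i]) = w (u @ [i])" if "i < f (length u)" for i
    using child_in_strict_descendants[OF Suc.prems(1) that] Suc.prems(2) by auto
  ultimately show ?case unfolding open_path.simps by metis
qed simp

lemma open_path_measurable:
  fixes P :: "real measure"
  assumes "sets P = sets borel" "\<And>k. S k \<in> sets borel"
    and "u \<in> sph_tree f" "strict_descendants f u \<subseteq> J"
  shows "{w \<in> space (PiM J (\<lambda>_. P)). open_path f S m w u} \<in> sets (PiM J (\<lambda>_. P))"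
  using assms(3,4)
proof (induction m arbitrary: u)
  case (Suc m)
  let ?M = "PiM J (\<lambda>_. P)"
  have "{w \<in> space ?M. w (u @ [i]) \<in> S (length u) \<and> open_path f S m w (u @ [i])} \<in> sets ?M"
    if "i < f (length u)" for i
  proof (rule sets.sets_Collect_conj)
    show "{w \<in> space ?M. open_path f S m w (u @ [i])} \<in> sets ?M"
      by (rule Suc.IH[OF child_in_sph_tree[OF Suc.prems(1) that]])
        (rule order_trans[OF strict_descendants_child Suc.prems(2)])
    have "u @ [i] \<in> J" using child_in_strict_descendants[OF Suc.prems(1) that] Suc.prems(2) by blast
    then show "{w \<in> space ?M. w (u @ [i]) \<in> S (length u)} \<in> sets ?M"
      by (rule PiM_coordinate_event[OF assms(1,2)])
  qed
  then have "{w \<in> space ?M. \<exists>i\<in>{..<f (length u)}.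
      w (u @ [i]) \<in> S (length u) \<and> open_path f S m w (u @ [i])} \<in> sets ?M"
    by (intro sets.sets_Collect_countable_Ex') auto
  then show ?case by (simp only: open_path.simps Bex_def lessThan_iff)
qed simp

text \<open>
  Inside the tree of open edges, the probability of extinction within \<open>m\<close> generations obeys a
  Galton--Watson recursion: a child of a vertex of generation \<open>k\<close> fails to lead \<open>m\<close> generations
  further with probability at most \<open>1 - p * (1 - e)\<close>, where \<open>p\<close> is the probability that its edge is
  open, and the \<open>f k\<close> children fail independently. Hence a common bound \<open>e\<close> reproduces itself as
  soon as it satisfies the inequality assumed here for every \<open>k\<close>.
\<close>

lemma prob_no_open_path_le:
  fixes P :: "real measure" and S :: "nat \<Rightarrow> real set"
  assumes P: "prob_space P" "sets P = sets borel" and S: "\<And>k. S k \<in> sets borel"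
    and f: "\<forall>n. 1 \<le> f n" and e: "0 \<le> e"
    and contract: "\<And>k. (1 - measure P (S k) * (1 - e)) ^ f k \<le> e"
    and u: "u \<in> sph_tree f"
  defines "M \<equiv> PiM (tree_edges (sph_tree f)) (\<lambda>_. P)"
  shows "measure M {w \<in> space M. \<not> open_path f S m w u} \<le> e"
  using u
proof (induction m arbitrary: u)
  case (Suc m)
  interpret N: prob_space P by fact
  interpret M: prob_space M unfolding M_def by (intro prob_space_PiM P)
  let ?n = "length u" let ?E = "tree_edges (sph_tree f)"
  let ?p = "measure P (S ?n)"
  let ?Q = "\<lambda>i w. w (u @ [i]) \<in> S ?n \<and> open_path f S m w (u @ [i])"
  let ?K = "\<lambda>i. insert (u @ [i]) (strict_descendants f (u @ [i]))"
  note tree = child_in_sph_tree[OF Suc.prems]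
  have KE: "?K i \<subseteq> ?E" if "i < f ?n" for i
    using child_in_strict_descendants[OF Suc.prems that] strict_descendants_subset_tree_edges by blast
  have Sn: "S ?n \<in> sets P" using P(2) S by simp
  have "0 < f ?n" using f by (auto simp: Suc_le_eq)
  then have ne: "?E \<noteq> {}" using KE by blast
  have comp: "{w \<in> space (PiM J (\<lambda>_. P)). w x \<in> S ?n} \<in> sets (PiM J (\<lambda>_. P))" if "x \<in> J" for x J
    using that by (rule PiM_coordinate_event[OF P(2) S])
  have Qm: "{w \<in> space (PiM J (\<lambda>_. P)). ?Q i w} \<in> sets (PiM J (\<lambda>_. P))"
    if "i < f ?n" "?K i \<subseteq> J" for i J
    using that by (intro sets.sets_Collect_conj comp open_path_measurable P S tree) auto
  have fail: "measure M {w \<in> space M. \<not> ?Q i w} \<le> 1 - ?p * (1 - e)" if i: "i < f ?n" for i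
  proof -
    let ?R = "\<lambda>b w. if b then w (u @ [i]) \<in> S ?n else open_path f S m w (u @ [i])"
    let ?H = "\<lambda>b. if b then {u @ [i]} else strict_descendants f (u @ [i])"
    have "measure M {w \<in> space M. \<forall>b\<in>{True, False}. ?R b w}
        = (\<Prod>b\<in>{True, False}. measure M {w \<in> space M. ?R b w})"
      unfolding M_def
    proof (rule measure_PiM_disjoint_blocks[where K = ?H])
      show "disjoint_family_on ?H {True, False}"
        by (auto simp: disjoint_family_on_def strict_descendants_def)
      show "{w \<in> space (PiM (?H b) (\<lambda>_. P)). ?R b w} \<in> sets (PiM (?H b) (\<lambda>_. P))" for b
        using comp[of "u @ [i]" "{u @ [i]}"] open_path_measurable[OF P(2) S tree[OF i] subset_refl, where m=m] by auto
      show "?R b (restrict w (?H b)) = ?R b w" for b w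
        using open_path_restrict[OF tree[OF i] subset_refl] by auto
    qed (use KE[OF i] ne P in auto)
    then have prod: "measure M {w \<in> space M. ?Q i w}
        = measure M {w \<in> space M. w (u @ [i]) \<in> S ?n} * measure M {w \<in> space M. open_path f S m w (u @ [i])}"
      by (simp add: ex_bool_eq)
    have edge: "measure M {w \<in> space M. w (u @ [i]) \<in> S ?n} = ?p"
    proof -
      interpret product_prob_space "\<lambda>_. P" ?E by unfold_locales
      show ?thesis unfolding M_def measure_def
        using emeasure_PiM_Collect_single[of "u @ [i]" "S ?n"] KE[OF i] Sn by simp
    qed
    have "{w \<in> space M. open_path f S m w (u @ [i])} \<in> sets M"
      unfolding M_def by (intro open_path_measurable P S tree i strict_descendants_subset_tree_edges)
    from M.prob_neg[OF this] Suc.IH[OF tree[OF i]]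
    have "1 - e \<le> measure M {w \<in> space M. open_path f S m w (u @ [i])}" by linarith
    then have "?p * (1 - e) \<le> measure M {w \<in> space M. ?Q i w}"
      unfolding prod edge by (intro mult_left_mono) auto
    then show ?thesis
      using M.prob_neg[of "?Q i"] Qm[OF i KE[OF i], folded M_def] by linarith
  qed
  have "measure M {w \<in> space M. \<forall>i\<in>{..<f ?n}. \<not> ?Q i w}
      = (\<Prod>i<f ?n. measure M {w \<in> space M. \<not> ?Q i w})"
    unfolding M_def
  proof (rule measure_PiM_disjoint_blocks[where K = ?K])
    show "disjoint_family_on ?K {..<f ?n}"
      by (auto simp: disjoint_family_on_def strict_descendants_def)
    show "{w \<in> space (PiM (?K i) (\<lambda>_. P)). \<not> ?Q i w} \<in> sets (PiM (?K i) (\<lambda>_. P))"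
      if "i \<in> {..<f ?n}" for i
      using Qm[of i "?K i"] that by (intro sets.sets_Collect_neg) auto
    show "(\<not> ?Q i (restrict w (?K i))) = (\<not> ?Q i w)" if "i \<in> {..<f ?n}" for i w
      using open_path_restrict[OF tree, of i "?K i" S m w] that by auto
  qed (use KE ne P \<open>0 < f ?n\<close> in auto)
  also have "\<dots> \<le> (\<Prod>i<f ?n. 1 - ?p * (1 - e))"
    using fail by (intro prod_mono) auto
  also have "\<dots> \<le> e" using contract[of ?n] by simp
  finally have "measure M {w \<in> space M. \<forall>i\<in>{..<f ?n}. \<not> ?Q i w} \<le> e" .
  moreover have "(\<not> open_path f S (Suc m) w u) = (\<forall>i\<in>{..<f ?n}. \<not> ?Q i w)" for w by auto
  ultimately show ?case by (simp only:)
qed (simp add: e)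

lemma open_path_Suc_imp: "open_path f S (Suc m) w u \<Longrightarrow> open_path f S m w u"
proof (induction m arbitrary: u)
  case (Suc m) then show ?case by (metis open_path.simps(2))
qed simp

lemma open_path_vertex:
  assumes "open_path f S m w u" "u \<in> sph_tree f"
  shows "\<exists>v. u @ v \<in> sph_tree f \<and> length v = m \<and> (\<forall>k<m. w (u @ take (Suc k) v) \<in> S (length u + k))"
  using assms
proof (induction m arbitrary: u)
  case (Suc m)
  then obtain i where i: "i < f (length u)" "w (u @ [i]) \<in> S (length u)" "open_path f S m w (u @ [i])"
    by auto
  from Suc.IH[OF i(3) child_in_sph_tree[OF Suc.prems(2) i(1)]]
  obtain v where v: "u @ [i] @ v \<in> sph_tree f" "length v = m"
    "\<And>k. k < m \<Longrightarrow> w (u @ [i] @ take (Suc k) v) \<in> S (length u + Suc k)" by auto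
  have "w (u @ take (Suc k) (i # v)) \<in> S (length u + k)" if "k < Suc m" for k
    using that i(2) v(3) by (cases k) auto
  with v show ?case by (intro exI[of _ "i # v"]) auto
qed auto

text \<open>
  The edges of the first \<open>N\<close> generations are unconstrained; there are finitely many of them, so that
  their total weight bounds what they contribute to any path.
\<close>

lemma explosive_if_open_paths:
  assumes f: "\<forall>n. 1 \<le> f n" and w: "\<And>e. e \<in> tree_edges (sph_tree f) \<Longrightarrow> 0 \<le> w e"
    and a: "\<And>k. 0 \<le> a k" "summable a"
    and op: "\<And>m. open_path f (\<lambda>k. if k < N then UNIV else {..a k}) m w []"
  shows "explosive (sph_tree f) w"
proof -
  let ?T = "sph_tree f" let ?gen = "\<lambda>n. {v \<in> ?T. length v = n}"
  define C where "C j = (\<Sum>e\<in>?gen (Suc j). \<bar>w e\<bar>)" for j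
  have root: "[] \<in> ?T" by (simp add: sph_tree_def)
  have fin: "finite (path_weight w ` ?gen n)" for n using finite_generation by blast
  have "min_weight ?T w m \<le> (\<Sum>j<N. C j) + suminf a" for m
  proof -
    obtain v where v: "v \<in> ?T" "length v = m"
      and wv: "\<And>k. k < m \<Longrightarrow> w (take (Suc k) v) \<in> (if k < N then UNIV else {..a k})"
      using open_path_vertex[OF op root, of m] by (simp only: append_Nil list.size(3) add_0) blast
    have "min_weight ?T w m \<le> path_weight w v"
      unfolding min_weight_def using v fin by (intro Min_le) auto
    also have "\<dots> = (\<Sum>j<m. w (take (Suc j) v))" by (simp add: path_weight_eq_sum_lessThan v(2))
    also have "\<dots> \<le> (\<Sum>j<m. (if j < N then C j else 0) + a j)"
    proof (intro sum_mono)
      fix j assume j: "j \<in> {..<m}"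
      show "w (take (Suc j) v) \<le> (if j < N then C j else 0) + a j"
      proof (cases "j < N")
        case True
        have "w (take (Suc j) v) \<le> \<bar>w (take (Suc j) v)\<bar>" by simp
        also have "\<dots> \<le> C j" unfolding C_def
          using j v by (intro member_le_sum[of _ _ "\<lambda>e. \<bar>w e\<bar>"]) (auto simp: finite_generation sph_tree_take)
        finally show ?thesis using True a(1)[of j] by simp
      qed (use wv[of j] j in auto)
    qed
    also have "\<dots> = (\<Sum>j\<in>{..<m} \<inter> {..<N}. C j) + (\<Sum>j<m. a j)"
      by (simp add: sum.distrib sum.If_cases lessThan_def)
    also have "\<dots> \<le> (\<Sum>j<N. C j) + suminf a"
      using a by (intro add_mono sum_mono2 sum_le_suminf) (auto simp: C_def sum_nonneg)
    finally show ?thesis .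
  qed
  moreover have "incseq (min_weight ?T w)"
  proof (rule incseq_SucI)
    fix n
    have "min_weight ?T w (Suc n) \<in> path_weight w ` ?gen (Suc n)"
      unfolding min_weight_def using fin generation_nonempty[OF f] by (intro Min_in) auto
    then obtain v where v: "v \<in> ?T" "length v = Suc n" "min_weight ?T w (Suc n) = path_weight w v" by auto
    have "min_weight ?T w n \<le> path_weight w (take n v)"
      unfolding min_weight_def using v fin by (intro Min_le) (auto simp: sph_tree_take)
    also have "\<dots> = (\<Sum>j<n. w (take (Suc j) v))"
      using v by (auto simp: path_weight_eq_sum_lessThan min_def intro!: sum.cong)
    also have "\<dots> \<le> path_weight w v"
      using w take_Suc_in_tree_edges[OF v(1), of n] v(2) by (simp add: path_weight_eq_sum_lessThan)
    finally show "min_weight ?T w n \<le> min_weight ?T w (Suc n)" using v by simp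
  qed
  ultimately obtain L where "min_weight ?T w \<longlonglongrightarrow> L" using incseq_convergent by blast
  then have "(\<lambda>n. ereal (min_weight ?T w n)) \<longlonglongrightarrow> ereal L" by simp
  then show ?thesis unfolding explosive_def by (intro exI[of _ "ereal L"]) auto
qed

text \<open>
  The numerical condition says that a vertex has, in the mean, so many children behind cheap edges
  that the extinction bound \<open>e\<close> reproduces itself, since \<open>(1 - x) ^ f k \<le> exp (- x * f k)\<close>. Declaring
  all edges in the first \<open>N\<close> generations open keeps the bound alive up to the root, whence the tree
  explodes with probability at least \<open>1 - e\<close>, for arbitrary \<open>e\<close>.
\<close>

lemma AE_explosive:
  fixes P :: "real measure"
  assumes P: "prob_space P" "sets P = sets borel" "AE x in P. 0 \<le> x" and f: "\<forall>n. 1 \<le> f n"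
    and thr: "\<And>e::real. 0 < e \<Longrightarrow> e < 1 \<Longrightarrow> \<exists>N a. (\<forall>k. 0 \<le> a k) \<and> summable a \<and>
      (\<forall>k\<ge>N. - ln e \<le> f k * measure P {..a k} * (1 - e))"
  shows "AE w in PiM (tree_edges (sph_tree f)) (\<lambda>_. P). explosive (sph_tree f) w"
proof -
  let ?T = "sph_tree f"
  define M where "M = PiM (tree_edges ?T) (\<lambda>_. P)"
  interpret N: prob_space P by fact
  interpret M: prob_space M unfolding M_def by (intro prob_space_PiM P)
  have "\<forall>e. \<exists>N a. 0 < e \<and> e < 1 \<longrightarrow> (\<forall>k. 0 \<le> a k) \<and> summable a \<and>
      (\<forall>k\<ge>N. - ln e \<le> f k * measure P {..a k} * (1 - e))" using thr by meson
  then obtain N a where Na: "\<And>e k. 0 < e \<Longrightarrow> e < 1 \<Longrightarrow> 0 \<le> a e k" "\<And>e. 0 < e \<Longrightarrow> e < 1 \<Longrightarrow> summable (a e)"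
      "\<And>e k. 0 < e \<Longrightarrow> e < 1 \<Longrightarrow> N e \<le> k \<Longrightarrow> - ln e \<le> f k * measure P {..a e k} * (1 - e)"
    by metis
  define S where "S e k = (if k < N e then UNIV else {..a e k})" for e k
  have S: "S e k \<in> sets borel" for e k by (simp add: S_def)
  define E where "E e m = {w \<in> space M. open_path f (S e) m w []}" for e m
  have root: "[] \<in> ?T" by (simp add: sph_tree_def)
  have Em: "E e m \<in> sets M" for e m unfolding E_def M_def
    using strict_descendants_subset_tree_edges by (intro open_path_measurable P S root)
  have Ege: "1 - e \<le> measure M (\<Inter>m. E e m)" if e: "0 < e" "e < 1" for e
  proof -
    have contract: "(1 - measure P (S e k) * (1 - e)) ^ f k \<le> e" for k
    proof (cases "k < N e")
      case True
      then have "measure P (S e k) = 1" using N.prob_space sets_eq_imp_space_eq[OF P(2)] by (simp add: S_def)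
      then show ?thesis using e f[rule_format, of k] power_decreasing[of 1 "f k" e] by simp
    next
      case False
      let ?q = "measure P {..a e k}"
      have "?q * (1 - e) \<le> 1 * 1" using e by (intro mult_mono) auto
      then have "(1 - ?q * (1 - e)) ^ f k \<le> exp (- (?q * (1 - e))) ^ f k"
        using exp_ge_add_one_self[of "- (?q * (1 - e))"] by (intro power_mono) auto
      also have "\<dots> = exp (- (f k * ?q * (1 - e)))"
        by (simp add: exp_of_nat_mult[symmetric] mult_ac)
      also have "\<dots> \<le> exp (ln e)" using Na(3)[OF e, of k] False by (subst exp_le_cancel_iff) auto
      finally show ?thesis using False e by (simp add: S_def)
    qed
    have "1 - e \<le> measure M (E e m)" for m
      using prob_no_open_path_le[of P "S e" f e "[]" m, OF P(1,2) S f _ contract root] e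
        M.prob_neg[of "\<lambda>w. open_path f (S e) m w []"] Em[of e m]
      by (simp add: E_def M_def)
    moreover have "decseq (E e)" by (auto simp: decseq_Suc_iff E_def simp del: open_path.simps intro: open_path_Suc_imp)
    then have "(\<lambda>m. measure M (E e m)) \<longlonglongrightarrow> measure M (\<Inter>m. E e m)"
      using Em by (intro M.finite_Lim_measure_decseq) auto
    ultimately show ?thesis by (intro LIMSEQ_le_const) auto
  qed
  let ?U = "\<Union>n. \<Inter>m. E (inverse (real (Suc (Suc n)))) m"
  have Um: "?U \<in> sets M" using Em by auto
  have "1 - inverse (real (Suc (Suc n))) \<le> measure M ?U" for n
  proof (rule order_trans[OF Ege])
    show "measure M (\<Inter>m. E (inverse (real (Suc (Suc n)))) m) \<le> measure M ?U"
      using Um by (intro M.finite_measure_mono) auto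
  qed (auto simp: field_simps)
  moreover have "(\<lambda>n. 1 - inverse (real (Suc (Suc n)))) \<longlonglongrightarrow> 1" using LIMSEQ_Suc[OF LIMSEQ_inverse_real_of_nat_add_minus[of 1]] by simp
  ultimately have "1 \<le> measure M ?U" by (intro LIMSEQ_le_const2) auto
  then have "AE w in M. w \<in> ?U" using Um by (intro M.AE_prob_1) (simp add: antisym)
  moreover have "AE w in M. \<forall>e\<in>tree_edges ?T. 0 \<le> w e"
    unfolding M_def using P
    by (subst AE_ball_countable) (auto intro!: AE_PiM_component)
  ultimately have "AE w in M. explosive ?T w"
  proof eventually_elim
    fix w assume "w \<in> ?U" and w: "\<forall>e\<in>tree_edges ?T. 0 \<le> w e"
    then obtain n where "\<And>m. open_path f (S (inverse (real (Suc (Suc n))))) m w []" by (auto simp: E_def)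
    then show "explosive ?T w" unfolding S_def
      using w by (intro explosive_if_open_paths[OF f _ Na(1,2)]) (auto simp: field_simps)
  qed
  then show ?thesis unfolding M_def .
qed

section \<open>The generalised inverse\<close>

lemma gen_inverse_le: "0 \<le> x \<Longrightarrow> y \<le> G x \<Longrightarrow> gen_inverse G y \<le> ennreal x"
  unfolding gen_inverse_def by (intro Inf_lower) auto

lemma le_of_gen_inverse_less:
  assumes "mono G" "gen_inverse G y < ennreal x"
  shows "y \<le> G x"
proof -
  from assms(2) obtain z where z: "0 \<le> z" "y \<le> G z" "ennreal z < ennreal x"
    unfolding gen_inverse_def Inf_less_iff by blast
  then have "z \<le> x" using ennreal_less_iff by fastforce
  with z(2) assms(1) show ?thesis by (meson monoD order_trans)
qed

lemma gen_inverse_mono: "y \<le> z \<Longrightarrow> gen_inverse G y \<le> gen_inverse G z"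
  unfolding gen_inverse_def by (intro Inf_superset_mono image_mono) auto

text \<open>
  A positive limit of \<open>G\<close> at 0 would force the quotients \<open>G (c * x) / G x\<close> to tend to 1, so control
  near 0 excludes it, and the generalised inverse cannot vanish at a positive level. In
  particular, the sum defining \<open>G\<close>-smallness diverges for bounded \<open>f\<close>.
\<close>

lemma gen_inverse_pos:
  assumes "controlled_near_0 G" "mono G" "\<And>x. G x \<le> 1" "0 < y"
  shows "0 < gen_inverse G y"
proof (rule ccontr)
  assume zero: "\<not> 0 < gen_inverse G y"
  obtain x0 where x0: "x0 > 0"
    and decay: "\<And>e. e > 0 \<Longrightarrow> \<exists>\<theta>>0. \<theta> < 1 \<and> (\<forall>x. 0 < x \<longrightarrow> x \<le> x0 \<longrightarrow> G (\<theta> * x) \<le> e * G x)"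
    using controlled_near_0_decay[OF assms(1)] by blast
  obtain \<theta> where \<theta>: "\<theta> > 0" "G (\<theta> * x0) \<le> y / 2 * G x0"
    using decay[of "y / 2"] assms(4) x0 by fastforce
  have "y / 2 * G x0 \<le> y / 2 * 1"
    using assms(3,4) by (intro mult_left_mono) auto
  with \<theta>(2) have "G (\<theta> * x0) < y" using assms(4) by linarith
  moreover have "gen_inverse G y < ennreal (\<theta> * x0)"
    using zero \<theta>(1) x0 by (simp add: not_gr_zero)
  then have "y \<le> G (\<theta> * x0)" by (rule le_of_gen_inverse_less[OF assms(2)])
  ultimately show False by simp
qed

section \<open>Smallness and explosion\<close>

lemma filterlim_sum_at_top_if_not_summable:
  fixes x :: "nat \<Rightarrow> real"
  assumes "\<And>k. 0 \<le> x k" "\<not> summable x"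
  shows "filterlim (\<lambda>n. \<Sum>k<n. x k) at_top sequentially"
  unfolding filterlim_at_top eventually_sequentially
proof
  fix Z
  have "\<exists>n. Z < (\<Sum>k<n. x k)"
    using assms summableI_nonneg_bounded[of x Z] by (meson linorder_not_le)
  then obtain n where "Z < (\<Sum>k<n. x k)" by blast
  then have "Z \<le> (\<Sum>k<m. x k)" if "n \<le> m" for m
    using sum_mono2[of "{..<m}" "{..<n}" x] assms(1) that by fastforce
  then show "\<exists>N. \<forall>n\<ge>N. Z \<le> (\<Sum>k<n. x k)" by blast
qed

text \<open>
  With \<open>q k = G\<^sup>-\<^sup>1 (1 / f k)\<close>, an edge of weight at most \<open>2 * q k\<close> has probability at least \<open>1 / f k\<close>.
  Enlarging the threshold by the constant factor \<open>1 / \<theta>\<close> multiplies this by at least \<open>1 / \<epsilon>\<close>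
  for large \<open>k\<close>, which makes the cheap edges supercritical while their thresholds remain summable.
\<close>

lemma G_small_imp_explosive:
  assumes G: "nonneg_distribution_function G" and con: "controlled_near_0 G"
    and f: "\<forall>n. 1 \<le> f n" and small: "G_small G f"
  shows "G_explosive G f"
  unfolding G_explosive_def edge_weights_def
proof (rule AE_explosive)
  note P = interval_measure_distribution[OF G]
  interpret P: real_distribution "interval_measure G" by (rule P(1))
  show "prob_space (interval_measure G)" "sets (interval_measure G) = sets borel"
    "AE x in interval_measure G. 0 \<le> x" using P(3) by (auto intro: P.prob_space_axioms)
  show "\<forall>n. 1 \<le> f n" by (rule f)
  have mG: "mono G" using P.cdf_nondecreasing unfolding P(2) by (auto intro: monoI)
  have G1: "G x \<le> 1" for x using P.cdf_bounded_prob[of x] unfolding P(2) .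
  have meas: "measure (interval_measure G) {..x} = G x" for x using P(2) by (simp add: cdf_def fun_eq_iff)
  define q where "q k = gen_inverse G (1 / real (f k))" for k
  obtain x0 where x0: "x0 > 0"
    and decay: "\<And>e. e > 0 \<Longrightarrow> \<exists>\<theta>>0. \<theta> < 1 \<and> (\<forall>x. 0 < x \<longrightarrow> x \<le> x0 \<longrightarrow> G (\<theta> * x) \<le> e * G x)"
    using controlled_near_0_decay[OF con] by blast
  have qpos: "0 < q k" for k
    unfolding q_def using f by (intro gen_inverse_pos[OF con mG G1]) (simp add: Suc_le_eq)
  obtain N0 where N0: "(\<Sum>n. q (n + N0)) < \<infinity>" using small by (auto simp: G_small_def q_def)
  define r where "r k = (if N0 \<le> k then enn2real (q k) else 0)" for k
  have qfin: "q (n + N0) < \<infinity>" for n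
    using le_less_trans[OF ennreal_term_le_suminf N0] by simp
  have "summable (\<lambda>n. enn2real (q (n + N0)))"
    using N0 qfin by (intro summable_suminf_not_top) (auto simp: less_top)
  then have "summable (\<lambda>n. r (n + N0))" by (simp add: r_def)
  then have rsum: "summable r" by simp
  have r0: "0 \<le> r k" for k by (simp add: r_def)
  fix e :: real assume e: "0 < e" "e < 1"
  \<comment> \<open>Chosen so that \<open>1 / \<epsilon>\<close> cheap children in the mean give the exponent \<open>(1 - e) / \<epsilon> \<ge> - ln e\<close>.\<close>
  define \<epsilon> where "\<epsilon> = (1 - e) / (1 - ln e)"
  have ln: "ln e < 0" using e by simp
  have "\<epsilon> > 0" using e ln unfolding \<epsilon>_def by (intro divide_pos_pos) linarith+
  from decay[OF this] obtain \<theta> where \<theta>: "\<theta> > 0" "\<theta> < 1"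
    "\<And>x. 0 < x \<Longrightarrow> x \<le> x0 \<Longrightarrow> G (\<theta> * x) \<le> \<epsilon> * G x" by blast
  define a where "a k = 2 * r k / \<theta>" for k
  have asum: "summable a" unfolding a_def using rsum by (intro summable_divide summable_mult)
  have "eventually (\<lambda>k. a k < x0) sequentially"
    using summable_LIMSEQ_zero[OF asum] x0 by (rule order_tendstoD(2))
  then obtain N1 where N1: "\<And>k. N1 \<le> k \<Longrightarrow> a k < x0" by (auto simp: eventually_sequentially)
  show "\<exists>N a. (\<forall>k. 0 \<le> a k) \<and> summable a \<and>
      (\<forall>k\<ge>N. - ln e \<le> real (f k) * measure (interval_measure G) {..a k} * (1 - e))"
  proof (intro exI[of _ "max N0 N1"] exI[of _ a] conjI allI impI asum)
    show "0 \<le> a k" for k using r0 \<theta>(1) by (simp add: a_def)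
    fix k assume k: "max N0 N1 \<le> k"
    have fin: "q k < top" using qfin[of "k - N0"] k by simp
    then have qr: "q k = ennreal (r k)" using k by (simp add: r_def)
    then have rk: "0 < r k" using qpos[of k] by simp
    then have "q k < ennreal (2 * r k)" unfolding qr by (subst ennreal_less_iff) auto
    then have "1 / real (f k) \<le> G (2 * r k)"
      unfolding q_def by (rule le_of_gen_inverse_less[OF mG])
    also have "2 * r k = \<theta> * a k" using \<theta> by (simp add: a_def)
    also have "G (\<theta> * a k) \<le> \<epsilon> * G (a k)"
      using N1[of k] k rk \<theta>(1) by (intro \<theta>(3)) (auto simp: a_def)
    finally have "1 / real (f k) \<le> \<epsilon> * G (a k)" .
    then have "1 \<le> f k * (\<epsilon> * G (a k))"
      using f[rule_format, of k] by (simp add: field_simps)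
    then have "1 - ln e \<le> f k * G (a k) * (1 - e)"
      using ln unfolding \<epsilon>_def by (simp add: field_simps)
    then show "- ln e \<le> real (f k) * measure (interval_measure G) {..a k} * (1 - e)"
      unfolding meas by linarith
  qed
qed

text \<open>
  With \<open>q k = G\<^sup>-\<^sup>1 (1 / f k)\<close>, the inverse temperature \<open>\<beta> k\<close> of the first passage argument is a large
  multiple of \<open>1 / q k\<close>: it must make \<open>f k * E exp (- \<beta> k * X)\<close> small, and the Laplace transform is
  at most a constant multiple of \<open>G (1 / \<beta> k)\<close>, which is a small multiple of \<open>G (q k / 2) \<le> 1 / f k\<close>. Monotonicity
  of \<open>f\<close> makes \<open>\<beta>\<close> nondecreasing, and the barrier diverges with the sum of the \<open>q k\<close>.
\<close>

lemma G_explosive_imp_small: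
  assumes G: "nonneg_distribution_function G" and con: "controlled_near_0 G"
    and f: "\<forall>n. 1 \<le> f n" and mf: "mono f" and expl: "G_explosive G f"
  shows "G_small G f"
proof (rule ccontr)
  assume ns: "\<not> G_small G f"
  note P = interval_measure_distribution[OF G]
  interpret P: real_distribution "interval_measure G" by (rule P(1))
  have mG: "mono G" using P.cdf_nondecreasing unfolding P(2) by (auto intro: monoI)
  have G1: "G x \<le> 1" for x using P.cdf_bounded_prob[of x] unfolding P(2) .
  define q where "q k = gen_inverse G (1 / real (f k))" for k
  obtain x0 where x0: "x0 > 0"
    and decay: "\<And>e. e > 0 \<Longrightarrow> \<exists>\<theta>>0. \<theta> < 1 \<and> (\<forall>x. 0 < x \<longrightarrow> x \<le> x0 \<longrightarrow> G (\<theta> * x) \<le> e * G x)"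
    using controlled_near_0_decay[OF con] by blast
  obtain c K where cK: "c > 1" "K > 0" "\<And>x. 0 < x \<Longrightarrow> G (c * x) \<le> K * G x"
    using controlled_near_0_le_ratio[OF con mG G1] by blast
  obtain B where B: "B > 0"
    "\<And>y. y > 0 \<Longrightarrow> (\<integral>\<^sup>+ x. ennreal (exp (- x / y)) \<partial>interval_measure G) \<le> ennreal (B * G y)"
    using laplace_le_cdf[OF P(1,3) cK(1,2)] cK(3) unfolding P(2) by blast
  obtain \<theta> where \<theta>: "\<theta> > 0" "\<theta> < 1"
    "\<And>x. 0 < x \<Longrightarrow> x \<le> x0 \<Longrightarrow> G (\<theta> * x) \<le> 1 / (4 * exp 1 * B) * G x"
    using decay[of "1 / (4 * exp 1 * B)"] B(1) by auto
  have qpos: "0 < q k" for k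
    unfolding q_def using f by (intro gen_inverse_pos[OF con mG G1]) (simp add: Suc_le_eq)
  \<comment> \<open>Truncation at \<open>x0\<close> keeps within the range where \<open>G\<close> is controlled, and takes care of \<open>q k = \<infinity>\<close>,
      which happens if \<open>f k = 1\<close> and \<open>G\<close> does not attain 1.\<close>
  define x where "x k = enn2real (min (q k) (ennreal x0))" for k
  have fin: "min (q k) (ennreal x0) < top" for k by (simp add: min_less_iff_disj)
  then have ex: "ennreal (x k) = min (q k) (ennreal x0)" for k by (simp add: x_def)
  have xpos: "0 < x k" for k
    using qpos[of k] x0 ex[of k] by (metis ennreal_eq_0_iff enn2real_nonneg ennreal_less_zero_iff min_less_iff_conj x_def)
  have xle: "x k \<le> x0" for k
    using ex[of k] x0 by (metis ennreal_le_iff less_imp_le min.cobounded2)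
  have qanti: "q m \<le> q k" if "k \<le> m" for k m
    unfolding q_def using f mf that
    by (intro gen_inverse_mono divide_left_mono) (auto simp: mono_def Suc_le_eq)
  have xanti: "x m \<le> x k" if "k \<le> m" for k m
  proof -
    have "ennreal (x m) \<le> ennreal (x k)" unfolding ex using qanti[OF that] by (intro min.mono) auto
    then show ?thesis using xpos[of k] by (simp add: ennreal_le_iff)
  qed
  have nsx: "\<not> summable x"
  proof
    assume sx: "summable x"
    have "eventually (\<lambda>k. x k < x0) sequentially"
      using summable_LIMSEQ_zero[OF sx] x0 by (rule order_tendstoD(2))
    then obtain N where N: "\<And>k. N \<le> k \<Longrightarrow> x k < x0" by (auto simp: eventually_sequentially)
    have qx: "q k = ennreal (x k)" if "N \<le> k" for k
    proof -
      have "ennreal (x k) < ennreal x0" using N[OF that] xpos[of k] by (simp add: ennreal_less_iff)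
      then show ?thesis unfolding ex by (auto simp: min_def split: if_splits)
    qed
    have "(\<Sum>n. q (n + N)) = (\<Sum>n. ennreal (x (n + N)))" by (intro suminf_cong qx) auto
    also have "\<dots> = ennreal (\<Sum>n. x (n + N))"
      using sx xpos by (intro suminf_ennreal2) (auto intro: less_imp_le)
    also have "\<dots> < \<infinity>" by simp
    finally have "G_small G f" unfolding G_small_def q_def by blast
    with ns show False by simp
  qed
  define \<beta> where "\<beta> k = 2 / (\<theta> * x k)" for k
  have "\<not> (AE w in PiM (tree_edges (sph_tree f)) (\<lambda>_. interval_measure G). explosive (sph_tree f) w)"
  proof (rule not_AE_explosive[where \<beta> = \<beta>])
    show "prob_space (interval_measure G)" "sets (interval_measure G) = sets borel"
      by (auto intro: P.prob_space_axioms)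
    show "\<forall>n. 1 \<le> f n" by (rule f)
    show "mono \<beta>" unfolding \<beta>_def
      using xanti xpos \<theta>(1) by (intro monoI divide_left_mono mult_left_mono mult_pos_pos) auto
    show "0 < \<beta> k" for k using xpos \<theta>(1) by (simp add: \<beta>_def)
    have "\<not> summable (\<lambda>k. \<theta> / 2 * x k)"
      using nsx \<theta>(1) by (subst summable_cmult_iff) auto
    then show "filterlim (\<lambda>n. \<Sum>k<n. 1 / \<beta> k) at_top sequentially"
      using \<theta>(1) xpos by (intro filterlim_sum_at_top_if_not_summable) (auto simp: \<beta>_def less_imp_le)
    fix k
    define y where "y = \<theta> * (x k / 2)"
    have y: "y > 0" using \<theta>(1) xpos by (simp add: y_def)
    have "G y \<le> 1 / (4 * exp 1 * B) * G (x k / 2)"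
      unfolding y_def using xpos[of k] xle[of k] by (intro \<theta>(3)) auto
    also have "G (x k / 2) \<le> 1 / real (f k)"
    proof (rule ccontr)
      assume "\<not> G (x k / 2) \<le> 1 / real (f k)"
      then have "q k \<le> ennreal (x k / 2)"
        unfolding q_def using xpos[of k] by (intro gen_inverse_le) auto
      also have "\<dots> < ennreal (x k)" using xpos[of k] by (subst ennreal_less_iff) auto
      also have "\<dots> \<le> q k" unfolding ex by simp
      finally show False by simp
    qed
    then have "1 / (4 * exp 1 * B) * G (x k / 2) \<le> 1 / (4 * exp 1 * B) * (1 / real (f k))"
      using B(1) by (intro mult_left_mono) auto
    finally have "exp 1 * (B * G y) \<le> exp 1 * (B * (1 / (4 * exp 1 * B) * (1 / real (f k))))"
      using B(1) by (intro mult_left_mono) auto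
    also have "\<dots> = 1 / (4 * real (f k))" using B(1) by simp
    finally have Gy: "exp 1 * (B * G y) \<le> 1 / (4 * real (f k))" .
    have "(\<integral>\<^sup>+ t. ennreal (exp (1 - \<beta> k * t)) \<partial>interval_measure G)
        = (\<integral>\<^sup>+ t. ennreal (exp 1) * ennreal (exp (- t / y)) \<partial>interval_measure G)"
      by (intro nn_integral_cong)
        (auto simp: ennreal_mult[symmetric] exp_add[symmetric] \<beta>_def y_def mult_ac)
    also have "\<dots> = ennreal (exp 1) * (\<integral>\<^sup>+ t. ennreal (exp (- t / y)) \<partial>interval_measure G)"
      by (intro nn_integral_cmult) simp
    also have "\<dots> \<le> ennreal (exp 1) * ennreal (B * G y)"
      by (intro mult_left_mono B(2) y) simp
    also have "\<dots> = ennreal (exp 1 * (B * G y))" by (subst ennreal_mult') auto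
    also have "\<dots> \<le> ennreal (1 / (4 * real (f k)))" using Gy by (rule ennreal_leI)
    finally show "(\<integral>\<^sup>+ t. ennreal (exp (1 - \<beta> k * t)) \<partial>interval_measure G) \<le> ennreal (1 / (4 * real (f k)))" .
  qed
  with expl show False unfolding G_explosive_def edge_weights_def by (rule notE[rotated])
qed

theorem theorem1p7:
  fixes G :: "real \<Rightarrow> real" and f :: "nat \<Rightarrow> nat"
  assumes "nonneg_distribution_function G"
    and "controlled_near_0 G"
    and "\<forall>n. 1 \<le> f n"
    and "mono f"
  shows "G_small G f \<longleftrightarrow> G_explosive G f"
  using G_small_imp_explosive[OF assms(1-3)] G_explosive_imp_small[OF assms] by blast

end
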